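(* Let $\mathcal M$ be a real symmetric $2d\times 2d$ matrix, $H(z)=\frac12\langle\mathcal Mz,z\rangle$ for $z=(x,\xi)\in\mathbb R^{2d}$, and let $u$ be the solution of the Schrödinger equation $i\hbar\,\partial_t u(x,t)=H_Du(x,t)$ with $\hbar=1/(2\pi)$ and initial datum $u(\cdot,0)=u_0\in\mathcal S(\mathbb R^d)$, i.e. $u(\cdot,t)=\hat S_tu_0$. Let $M,N$ be real symmetric positive-definite $d\times d$ matrices and suppose that for some $t_1$ and some constant $c>0$, $$|u(x,0)|\le c\,e^{-\pi Mx\cdot x},\qquad |u(x,t_1)|\le c\,e^{-\pi Nx\cdot x},\qquad x\in\mathbb R^d.$$ Assume that the symplectic matrix $S_{t_1}=\exp(t_1J\mathcal M)=\begin{pmatrix}A&B(t_1)\\C&D\end{pmatrix}$ has invertible upper-right block $B(t_1)$. Let $\lambda_1,\dots,\lambda_d$ be the eigenvalues of $MB(t_1)^TNB(t_1)$. If $\lambda_j>1$ for some $j\in\{1,\dots,d\}$, then $u_0\equiv 0$.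
   Context: $J=\begin{pmatrix}0_d&I_d\\-I_d&0_d\end{pmatrix}$; $\mathrm{Sp}(d,\mathbb R)=\{S\in\mathbb R^{2d\times2d}:S^TJS=J\}$, with $d\times d$ block decomposition $S=\begin{pmatrix}A&B\\C&D\end{pmatrix}$. $H_D$ is the Weyl quantization of $H$: $H_Df(x)=\int_{\mathbb R^{2d}}e^{2\pi i(x-y)\cdot\xi}H\big(\tfrac{x+y}{2},\xi\big)f(y)\,dy\,d\xi$. The cross-Wigner distribution is $W(f,g)(x,\xi)=\int f(x+t/2)\overline{g(x-t/2)}e^{-2\pi i\xi\cdot t}dt$, and a metaplectic operator with projection $S\in\mathrm{Sp}(d,\mathbb R)$ is a unitary $\hat S$ on $L^2(\mathbb R^d)$ with $W(\hat Sf,\hat Sg)(z)=W(f,g)(S^{-1}z)$ for all $f,g,z$. The flow $S_t=\exp(tJ\mathcal M)$ is a one-parameter subgroup of $\mathrm{Sp}(d,\mathbb R)$, and $t\mapsto\hat S_t$ is its unique continuous lift to metaplectic operators with $\hat S_0=\mathrm{id}$ ($\hat S_t$ has projection $S_t$); the solution of the initial value problem is $u(\cdot,t)=\hat S_tu_0$. *)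

theory Defs
  imports "HOL-Analysis.Analysis"
begin

definition pjoin :: "real^('n::finite) \<Rightarrow> real^'n \<Rightarrow> real^('n + 'n)" where
  "pjoin x \<xi> = (\<chi> k. case k of Inl i \<Rightarrow> x $ i | Inr i \<Rightarrow> \<xi> $ i)"

definition ppos :: "real^('n + 'n) \<Rightarrow> real^'n" where
  "ppos z = (\<chi> i. z $ Inl i)"

definition pmom :: "real^('n + 'n) \<Rightarrow> real^'n" where
  "pmom z = (\<chi> i. z $ Inr i)"

definition Jmat :: "real^('n::finite + 'n)^('n + 'n)" where
  "Jmat = (\<chi> k l. case (k, l) of
       (Inl i, Inr j) \<Rightarrow> (if i = j then 1 else 0)
     | (Inr i, Inl j) \<Rightarrow> (if i = j then -1 else 0)
     | _ \<Rightarrow> 0)"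

definition ublock :: "real^('n::finite + 'n)^('n + 'n) \<Rightarrow> real^'n^'n" where
  "ublock S = (\<chi> i j. S $ Inl i $ Inr j)"

fun matpow :: "real^('m::finite)^'m \<Rightarrow> nat \<Rightarrow> real^'m^'m" where
  "matpow A 0 = mat 1"
| "matpow A (Suc n) = A ** matpow A n"

definition mexp :: "real^('m::finite)^'m \<Rightarrow> real^'m^'m" where
  "mexp A = (\<Sum>n. (1 / fact n) *\<^sub>R matpow A n)"

definition symp_flow :: "real^('n::finite + 'n)^('n + 'n) \<Rightarrow> real \<Rightarrow> real^('n + 'n)^('n + 'n)" where
  "symp_flow MM t = mexp (t *\<^sub>R (Jmat ** MM))"

fun dderiv :: "(real^('n::finite) \<Rightarrow> complex) \<Rightarrow> (real^'n) list \<Rightarrow> real^'n \<Rightarrow> complex" where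
  "dderiv f [] = f"
| "dderiv f (v # vs) = (\<lambda>x. frechet_derivative (dderiv f vs) (at x) v)"

definition schwartz :: "(real^('n::finite) \<Rightarrow> complex) \<Rightarrow> bool" where
  "schwartz f \<longleftrightarrow>
     (\<forall>vs x. dderiv f vs differentiable at x) \<and>
     (\<forall>vs (m::nat). \<exists>C. \<forall>x. (1 + norm x) ^ m * norm (dderiv f vs x) \<le> C)"

definition sq_int :: "(real^('n::finite) \<Rightarrow> complex) \<Rightarrow> bool" where
  "sq_int f \<longleftrightarrow> f \<in> borel_measurable lborel \<and> integrable lborel (\<lambda>x. (cmod (f x))\<^sup>2)"

definition L2norm :: "(real^('n::finite) \<Rightarrow> complex) \<Rightarrow> real" where
  "L2norm f = sqrt (LINT x|lborel. (cmod (f x))\<^sup>2)"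

text \<open>Operators act on representatives; unitarity on L^2 is stated modulo null sets.\<close>
definition unitary_L2 :: "((real^('n::finite) \<Rightarrow> complex) \<Rightarrow> (real^'n \<Rightarrow> complex)) \<Rightarrow> bool" where
  "unitary_L2 T \<longleftrightarrow>
     (\<forall>f. sq_int f \<longrightarrow> sq_int (T f) \<and> L2norm (T f) = L2norm f) \<and>
     (\<forall>f g. sq_int f \<longrightarrow> sq_int g \<longrightarrow> (AE x in lborel. f x = g x) \<longrightarrow>
        (AE x in lborel. T f x = T g x)) \<and>
     (\<forall>f g a b. sq_int f \<longrightarrow> sq_int g \<longrightarrow>
        (AE x in lborel. T (\<lambda>y. a * f y + b * g y) x = a * T f x + b * T g x)) \<and>
     (\<forall>g. sq_int g \<longrightarrow> (\<exists>f. sq_int f \<and> (AE x in lborel. T f x = g x)))"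

definition wigner :: "(real^('n::finite) \<Rightarrow> complex) \<Rightarrow> (real^'n \<Rightarrow> complex) \<Rightarrow> real^'n \<Rightarrow> real^'n \<Rightarrow> complex" where
  "wigner f g x \<xi> = (LINT t|lborel. f (x + (1/2) *\<^sub>R t) * cnj (g (x - (1/2) *\<^sub>R t))
                          * exp (- (2 * pi * \<i> * complex_of_real (\<xi> \<bullet> t))))"

definition metaplectic_with_proj ::
  "((real^('n::finite) \<Rightarrow> complex) \<Rightarrow> (real^'n \<Rightarrow> complex)) \<Rightarrow> real^('n + 'n)^('n + 'n) \<Rightarrow> bool" where
  "metaplectic_with_proj T S \<longleftrightarrow> unitary_L2 T \<and>
     (\<forall>f g z. sq_int f \<longrightarrow> sq_int g \<longrightarrow>
        wigner (T f) (T g) (ppos z) (pmom z)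
          = wigner f g (ppos (matrix_inv S *v z)) (pmom (matrix_inv S *v z)))"

definition metaplectic_lift ::
  "(real \<Rightarrow> (real^('n::finite) \<Rightarrow> complex) \<Rightarrow> (real^'n \<Rightarrow> complex)) \<Rightarrow> (real \<Rightarrow> real^('n + 'n)^('n + 'n)) \<Rightarrow> bool" where
  "metaplectic_lift Sh S \<longleftrightarrow>
     (\<forall>t. metaplectic_with_proj (Sh t) (S t)) \<and>
     (\<forall>f. sq_int f \<longrightarrow> (AE x in lborel. Sh 0 f x = f x)) \<and>
     (\<forall>f t. sq_int f \<longrightarrow> ((\<lambda>s. L2norm (\<lambda>x. Sh s f x - Sh t f x)) \<longlongrightarrow> 0) (at t))"

definition sym_pos_def :: "real^('n::finite)^'n \<Rightarrow> bool" where
  "sym_pos_def A \<longleftrightarrow> transpose A = A \<and> (\<forall>x. x \<noteq> 0 \<longrightarrow> x \<bullet> (A *v x) > 0)"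

definition mat_eigenvalue :: "real^('n::finite)^'n \<Rightarrow> real \<Rightarrow> bool" where
  "mat_eigenvalue A lam \<longleftrightarrow> (\<exists>v. v \<noteq> 0 \<and> A *v v = lam *\<^sub>R v)"

end

theory Submission
  imports Defs "HOL-Probability.Characteristic_Functions" "HOL-Complex_Analysis.Conformal_Mappings"
begin

text \<open>
  Write \<open>W\<close> for the Wigner distribution of \<open>u0\<close>. For fixed \<open>x, \<xi>\<close> and an eigenvector \<open>v = M w\<close>, the
  Gaussian bound on \<open>u0\<close> makes \<open>z \<mapsto> W(x, \<xi> + z v)\<close> entire with growth
  \<open>exp (2 \<pi> (v \<bullet> w) (Im z)\<^sup>2)\<close>. By symplectic covariance \<open>W\<close> is also the Wigner distribution of
  \<open>u(t1)\<close> read along the line \<open>p + s B v\<close> in position space, so on the real axis it decays like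
  \<open>exp (- 2 \<pi> b s\<^sup>2)\<close> for every \<open>b < N B v \<bullet> B v = \<lambda> (v \<bullet> w)\<close>. When \<open>\<lambda> > 1\<close> the decay beats the growth,
  and the Phragmen-Lindelof form of Hardy's theorem gives \<open>W = 0\<close>; Fourier injectivity in the second
  variable then gives \<open>\<bar>u0 x\<bar>\<^sup>2 = 0\<close>. Neither an integral formula for the metaplectic operator nor a
  diagonalisation of \<open>M\<close> and \<open>N\<close> is needed.
\<close>

section \<open>Hardy's theorem for entire functions\<close>

text \<open>
  The Phragmen-Lindelof argument runs on the strip \<open>0 \<le> Im w \<le> \<theta>\<close> under \<open>z = exp w\<close>, where the
  damping factor of order \<open>p > 2\<close> needs no branch of a power. The multiplier
  \<open>exp (z\<^sup>2 (b + \<i> \<gamma>))\<close> makes \<open>h\<close> bounded on both sides of the sector.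
\<close>
lemma sector_bound:
  fixes h :: "complex \<Rightarrow> complex" and a b C \<gamma> \<theta> :: real
  assumes hol: "h holomorphic_on UNIV"
    and growth: "\<And>z. cmod (h z) \<le> C * exp (a * (Im z)\<^sup>2)"
    and decay: "\<And>s. s \<ge> 0 \<Longrightarrow> cmod (h (of_real s)) \<le> C * exp (- b * s\<^sup>2)"
    and a: "0 \<le> a" and \<theta>: "0 < \<theta>" "\<theta> < pi / 2"
    and \<gamma>: "a * (sin \<theta>)\<^sup>2 + b * cos (2 * \<theta>) \<le> \<gamma> * sin (2 * \<theta>)"
    and w: "0 \<le> Im w" "Im w \<le> \<theta>"
  shows "cmod (h (exp w)) * exp (exp (2 * Re w) * (b * cos (2 * Im w) - \<gamma> * sin (2 * Im w)))
    \<le> C * exp 1"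
proof -
  \<comment> \<open>Any order strictly between 2 and \<open>pi / \<theta>\<close> would do: above 2
    it outgrows \<open>exp (2 * Re w)\<close>, and below \<open>pi / \<theta>\<close> the cosine in
    \<open>D\<close> stays positive on the whole strip. Its least value there is
    \<open>\<delta>\<close>, attained on both edges.\<close>
  define p where "p = 1 + pi / (2 * \<theta>)"
  define \<delta> where "\<delta> = cos (p * \<theta> / 2)"
  define B where "B = a + \<bar>b\<bar> + \<bar>\<gamma>\<bar>"
  \<comment> \<open>\<open>E\<close> is the real part of the multiplier's exponent
    \<open>exp (2 * w) * (b + \<i> * \<gamma>)\<close>. \<open>D\<close> is the real part of
    \<open>exp (p * (w - \<i> * \<theta> / 2))\<close>, centred on the midline of the strip.\<close>
  define E where "E w = exp (2 * Re w) * (b * cos (2 * Im w) - \<gamma> * sin (2 * Im w))" for w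
  define D where "D w = exp (p * Re w) * cos (p * (Im w - \<theta> / 2))" for w
  have p2: "p > 2" and p\<theta>: "p * \<theta> / 2 < pi / 2"
    using \<theta> by (auto simp: p_def field_simps)
  have \<delta>: "\<delta> > 0"
    unfolding \<delta>_def using p\<theta> p2 \<theta> by (intro cos_gt_zero_pi) (auto intro: less_le_trans[of _ 0])
  have C: "C \<ge> 0"
    using growth[of 0] norm_ge_zero[of "h 0"] by (simp del: norm_ge_zero)
  have B: "B \<ge> 0" using a by (simp add: B_def)
  have D_ge: "\<delta> * exp (p * Re u) \<le> D u" if "0 \<le> Im u" "Im u \<le> \<theta>" for u
  proof -
    have "\<bar>p * (Im u - \<theta> / 2)\<bar> \<le> p * \<theta> / 2"
      using that p2 by (auto simp: abs_mult abs_le_iff field_simps)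
    then have "cos (p * \<theta> / 2) \<le> cos \<bar>p * (Im u - \<theta> / 2)\<bar>"
      using p\<theta> by (intro cos_monotone_0_pi_le) auto
    then show ?thesis by (simp add: D_def \<delta>_def)
  qed
  have E_le: "E u \<le> (\<bar>b\<bar> + \<bar>\<gamma>\<bar>) * exp (2 * Re u)" for u
  proof -
    have "b * cos (2 * Im u) \<le> \<bar>b\<bar>"
      by (metis abs_cos_le_one abs_ge_self abs_mult mult_left_le abs_ge_zero order_trans)
    moreover have "- (\<gamma> * sin (2 * Im u)) \<le> \<bar>\<gamma>\<bar>"
      by (metis abs_ge_minus_self abs_ge_zero abs_mult abs_sin_le_one mult_left_le order_trans)
    ultimately show ?thesis
      by (simp add: E_def mult.commute[of _ "exp _"])
  qed
  \<comment> \<open>A crude bound valid everywhere, with \<open>B\<close> absorbing both the growth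
    of \<open>h\<close> and the multiplier. It serves on the two vertical sides of the rectangle
    below.\<close>
  have h_le: "cmod (h (exp u)) * exp (E u) \<le> C * exp (B * exp (2 * Re u))" for u
  proof -
    have "(Im (exp u))\<^sup>2 \<le> exp (2 * Re u)"
    proof -
      have "\<bar>Im (exp u)\<bar>\<^sup>2 \<le> (cmod (exp u))\<^sup>2" by (intro power_mono abs_Im_le_cmod) auto
      then show ?thesis by (simp add: exp_double)
    qed
    then have "cmod (h (exp u)) \<le> C * exp (a * exp (2 * Re u))"
      using C a by (intro order_trans[OF growth]) (auto intro!: mult_left_mono)
    then have "cmod (h (exp u)) * exp (E u) \<le> C * exp (a * exp (2 * Re u)) * exp ((\<bar>b\<bar> + \<bar>\<gamma>\<bar>) * exp (2 * Re u))"
      using E_le[of u] C by (intro mult_mono) auto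
    also have "\<dots> = C * exp (B * exp (2 * Re u))"
      by (simp add: B_def algebra_simps flip: exp_add)
    finally show ?thesis .
  qed
  \<comment> \<open>On the positive real axis the multiplier cancels the assumed decay
    exactly.\<close>
  have bottom: "cmod (h (exp u)) * exp (E u) \<le> C" if "Im u = 0" for u
  proof -
    have "exp u = of_real (exp (Re u))" using that by (simp add: complex_eq_iff Re_exp Im_exp)
    then have "cmod (h (exp u)) \<le> C * exp (- b * (exp (Re u))\<^sup>2)"
      using decay[of "exp (Re u)"] by simp
    moreover have "E u = b * (exp (Re u))\<^sup>2" using that by (simp add: E_def exp_double)
    ultimately show ?thesis by (simp add: exp_minus field_simps)
  qed
  \<comment> \<open>On the upper edge the hypothesis on \<open>\<gamma>\<close> says precisely that
    the total exponent is nonpositive.\<close>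
  have top: "cmod (h (exp u)) * exp (E u) \<le> C" if "Im u = \<theta>" for u
  proof -
    have "cmod (h (exp u)) * exp (E u) \<le> C * exp (a * (exp (Re u) * sin \<theta>)\<^sup>2) * exp (E u)"
      using growth[of "exp u"] that by (intro mult_right_mono) (auto simp: Im_exp)
    also have "\<dots> = C * exp (exp (2 * Re u) * (a * (sin \<theta>)\<^sup>2 + b * cos (2 * \<theta>) - \<gamma> * sin (2 * \<theta>)))"
      using that by (simp add: E_def power_mult_distrib algebra_simps flip: exp_add exp_double)
    also have "\<dots> \<le> C * 1"
      using \<gamma> C by (intro mult_left_mono) (auto simp: mult_le_0_iff)
    finally show ?thesis by simp
  qed
  have eps: "cmod (h (exp w)) * exp (E w) * exp (- \<epsilon> * D w) \<le> C * exp 1" if \<epsilon>: "\<epsilon> > 0" for \<epsilon>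
  proof -
    \<comment> \<open>The rectangle reaches past \<open>Re w\<close> on both sides. At
      \<open>L\<close> the crude exponent is at most 1, the origin of the factor
      \<open>exp 1\<close>; at \<open>R\<close> the damping dominates it. Using \<open>B + 1\<close>
      keeps both logarithms meaningful when \<open>B = 0\<close>.\<close>
    define L where "L = - \<bar>Re w\<bar> - \<bar>ln (B + 1)\<bar>"
    define R where "R = \<bar>Re w\<bar> + \<bar>ln ((B + 1) / (\<epsilon> * \<delta>))\<bar> / (p - 2)"
    define G where "G u = h (exp u) * exp (exp (2 * u) * (of_real b + \<i> * of_real \<gamma>))
        * exp (- of_real \<epsilon> * exp (of_real p * (u - \<i> * of_real (\<theta> / 2))))" for u :: complex
    define S where "S = cbox (Complex L 0) (Complex R \<theta>)"
    have normG: "cmod (G u) = cmod (h (exp u)) * exp (E u) * exp (- \<epsilon> * D u)" for u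
    proof -
      have "Re (exp (2 * u) * (of_real b + \<i> * of_real \<gamma>)) = E u"
        by (simp add: E_def Re_exp Im_exp algebra_simps)
      moreover have "Re (- of_real \<epsilon> * exp (of_real p * (u - \<i> * of_real (\<theta> / 2)))) = - \<epsilon> * D u"
        by (simp add: D_def Re_exp)
      ultimately show ?thesis
        by (simp only: G_def norm_mult norm_exp_eq_Re)
    qed
    have hole: "G holomorphic_on A" for A
    proof -
      have "(h \<circ> exp) holomorphic_on A"
        by (intro holomorphic_on_compose holomorphic_intros holomorphic_on_subset[OF hol]) auto
      then show ?thesis unfolding G_def o_def by (intro holomorphic_intros)
    qed
    have "0 \<le> \<bar>ln ((B + 1) / (\<epsilon> * \<delta>))\<bar> / (p - 2)" using p2 by simp
    then have LR: "L \<le> Re w" "Re w \<le> R" unfolding L_def R_def by linarith+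
    have "w \<in> S" using LR w by (auto simp: S_def in_cbox_complex_iff)
    have "cmod (G w) \<le> C * exp 1"
    proof (rule maximum_modulus_frontier[where S=S and f=G and \<xi>=w])
      show "G holomorphic_on interior S" "continuous_on (closure S) G"
        using hole holomorphic_on_imp_continuous_on by blast+
      show "bounded S" by (simp add: S_def bounded_cbox)
      show "w \<in> S" by fact
      fix u assume u: "u \<in> frontier S"
      then have "u \<in> S" "u \<notin> box (Complex L 0) (Complex R \<theta>)"
        by (auto simp: S_def frontier_cbox)
      then have u2: "0 \<le> Im u" "Im u \<le> \<theta>" and cases: "Im u = 0 \<or> Im u = \<theta> \<or> Re u = L \<or> Re u = R"
        by (auto simp: S_def in_cbox_complex_iff in_box_complex_iff)
      have De: "D u \<ge> \<delta> * exp (p * Re u)" using D_ge u2 by blast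
      have "\<delta> * exp (p * Re u) > 0" using \<delta> by simp
      with De have "D u \<ge> 0" by linarith
      then have *: "cmod (G u) \<le> cmod (h (exp u)) * exp (E u)"
        unfolding normG using \<epsilon> by (intro mult_left_le) auto
      have C1: "C \<le> C * exp 1" using C by (simp add: mult_le_cancel_left1)
      from cases show "cmod (G u) \<le> C * exp 1"
      proof (elim disjE)
        assume "Re u = L"
        have "exp (2 * L) \<le> exp (- ln (B + 1))" by (auto simp: L_def)
        also have "\<dots> = 1 / (B + 1)" using B by (simp add: exp_minus field_simps)
        finally have "B * exp (2 * L) \<le> 1" using B
          by (smt (verit) mult_left_mono mult.commute divide_less_eq_1 times_divide_eq_right mult_cancel_left1)
        with \<open>Re u = L\<close> have "C * exp (B * exp (2 * Re u)) \<le> C * exp 1"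
          using C by (intro mult_left_mono) auto
        with * h_le[of u] show ?thesis by linarith
      next
        assume R: "Re u = R"
        have "B + 1 = \<epsilon> * \<delta> * exp (ln ((B + 1) / (\<epsilon> * \<delta>)))" using B \<epsilon> \<delta> by simp
        also have "\<dots> \<le> \<epsilon> * \<delta> * exp ((p - 2) * R)"
        proof -
          have "0 \<le> (p - 2) * \<bar>Re w\<bar>" using p2 by simp
          moreover have "(p - 2) * R = (p - 2) * \<bar>Re w\<bar> + \<bar>ln ((B + 1) / (\<epsilon> * \<delta>))\<bar>"
            using p2 by (simp add: R_def distrib_left)
          ultimately have "ln ((B + 1) / (\<epsilon> * \<delta>)) \<le> (p - 2) * R" by linarith
          then show ?thesis using \<epsilon> \<delta> by (intro mult_left_mono) auto
        qed
        finally have "B * exp (2 * R) \<le> \<epsilon> * \<delta> * exp ((p - 2) * R) * exp (2 * R)"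
          by (intro mult_right_mono) auto
        also have "\<dots> = \<epsilon> * (\<delta> * exp (p * Re u))"
          by (simp add: R algebra_simps flip: exp_add)
        also have "\<dots> \<le> \<epsilon> * D u" using De \<epsilon> by (intro mult_left_mono) auto
        finally have "exp (B * exp (2 * Re u)) * exp (- \<epsilon> * D u) \<le> 1"
          by (simp add: R flip: exp_add)
        then have "C * (exp (B * exp (2 * Re u)) * exp (- \<epsilon> * D u)) \<le> C * 1"
          using C by (intro mult_left_mono)
        moreover have "cmod (G u) \<le> C * exp (B * exp (2 * Re u)) * exp (- \<epsilon> * D u)"
          unfolding normG by (intro mult_right_mono h_le) auto
        ultimately show ?thesis using C1 by (simp add: mult.assoc)
      qed (use * C1 top[of u] bottom[of u] in linarith)+
    qed
    then show ?thesis by (simp only: normG)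
  qed
  \<comment> \<open>The bound does not depend on \<open>\<epsilon>\<close>, so the damping can be
    removed at the fixed point \<open>w\<close>.\<close>
  have "((\<lambda>\<epsilon>. cmod (h (exp w)) * exp (E w) * exp (- \<epsilon> * D w)) \<longlongrightarrow>
      cmod (h (exp w)) * exp (E w) * exp (- 0 * D w)) (at_right 0)"
    by (intro tendsto_intros)
  then have "cmod (h (exp w)) * exp (E w) * exp (- 0 * D w) \<le> C * exp 1"
    by (rule tendsto_upperbound) (use eps in \<open>auto intro!: eventually_at_rightI[of 0 1]\<close>)
  then show ?thesis by (simp add: E_def)
qed

text \<open>
  As \<open>\<theta>\<close> tends to \<open>\<pi> / 2\<close>, the strict inequality \<open>a < b\<close> admits arbitrarily negative \<open>\<gamma>\<close> in the sector
  bound, which forces \<open>h\<close> to vanish inside the quadrant.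
\<close>
lemma hardy_entire:
  fixes h :: "complex \<Rightarrow> complex" and a b C :: real
  assumes hol: "h holomorphic_on UNIV"
    and growth: "\<And>z. cmod (h z) \<le> C * exp (a * (Im z)\<^sup>2)"
    and decay: "\<And>s. s \<ge> 0 \<Longrightarrow> cmod (h (of_real s)) \<le> C * exp (- b * s\<^sup>2)"
    and ab: "0 \<le> a" "a < b"
  shows "h 0 = 0"
proof -
  \<comment> \<open>On the ray of argument \<open>pi / 4\<close> the term in \<open>b\<close>
    vanishes and \<open>sin (2 * Im w) = 1\<close>. Taking \<open>\<gamma> = - n\<close> therefore
    bounds \<open>h\<close> by a constant times \<open>exp (- n * exp (2 * Re w))\<close> for every
    \<open>n\<close>.\<close>
  have zero: "h (exp w) = 0" if w: "Im w = pi / 4" for w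
  proof -
    have *: "cmod (h (exp w)) \<le> C * exp 1 * exp (- exp (2 * Re w) * real n)" for n
    proof -
      let ?f = "\<lambda>\<theta>. a * (sin \<theta>)\<^sup>2 + b * cos (2 * \<theta>) - (- real n) * sin (2 * \<theta>)"
      \<comment> \<open>At \<open>pi / 2\<close> the expression equals \<open>a - b < 0\<close>
        whatever \<open>n\<close> is, so by continuity an admissible angle beyond
        \<open>pi / 4\<close> exists for each \<open>n\<close>.\<close>
      have "(?f \<longlongrightarrow> ?f (pi / 2)) (at_left (pi / 2))"
        by (intro tendsto_intros)
      moreover have "?f (pi / 2) < 0" using ab by simp
      ultimately have "\<forall>\<^sub>F \<theta> in at_left (pi / 2). ?f \<theta> < 0"
        by (rule order_tendstoD)
      moreover have "\<forall>\<^sub>F \<theta> in at_left (pi / 2). \<theta> \<in> {pi / 4 <..< pi / 2}"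
        by (intro eventually_at_left_real) auto
      ultimately have "\<forall>\<^sub>F \<theta> in at_left (pi / 2). ?f \<theta> < 0 \<and> \<theta> \<in> {pi / 4 <..< pi / 2}"
        by (rule eventually_conj)
      then obtain \<theta> where \<theta>: "?f \<theta> < 0" "pi / 4 < \<theta>" "\<theta> < pi / 2"
        using eventually_happens'[OF trivial_limit_at_left_real] by force
      have "0 < \<theta>" using \<theta>(2) pi_gt_zero by linarith
      have "cmod (h (exp w)) * exp (exp (2 * Re w) * (b * cos (2 * Im w) - (- real n) * sin (2 * Im w)))
        \<le> C * exp 1"
        by (rule sector_bound[OF hol growth decay ab(1) \<open>0 < \<theta>\<close> \<theta>(3)]) (use \<theta> w in auto)
      then show ?thesis by (simp add: w exp_minus field_simps)
    qed
    have "(\<lambda>n. C * exp 1 * exp (- exp (2 * Re w) * real n)) \<longlonglongrightarrow> 0"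
    proof -
      have "(\<lambda>n. exp (- exp (2 * Re w)) ^ n) \<longlonglongrightarrow> 0"
        by (intro LIMSEQ_power_zero) auto
      then show ?thesis
        by (intro tendsto_mult_right_zero) (simp add: exp_of_nat_mult[symmetric] mult.commute)
    qed
    then have "cmod (h (exp w)) \<le> 0"
      by (rule tendsto_lowerbound) (use * in auto)
    then show ?thesis by simp
  qed
  \<comment> \<open>The zeros on the ray accumulate at the origin, and continuity carries the value
    0 there.\<close>
  have "(\<lambda>n. exp (Complex (- real n) (pi / 4))) \<longlonglongrightarrow> 0"
  proof (rule tendsto_norm_zero_cancel)
    have "(\<lambda>n. exp (-1::real) ^ n) \<longlonglongrightarrow> 0" by (intro LIMSEQ_power_zero) auto
    then show "(\<lambda>n. cmod (exp (Complex (- real n) (pi / 4)))) \<longlonglongrightarrow> 0"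
      by (simp add: norm_exp_eq_Re flip: exp_of_nat_mult)
  qed
  moreover have "isCont h 0"
    using holomorphic_on_imp_continuous_on[OF hol] by (simp add: continuous_on_eq_continuous_at)
  ultimately have "(\<lambda>n. h (exp (Complex (- real n) (pi / 4)))) \<longlonglongrightarrow> h 0"
    by (rule isCont_tendsto_compose[rotated])
  then show ?thesis by (simp add: zero LIMSEQ_const_iff)
qed

section \<open>Matrix exponential and phase-space vectors\<close>

text \<open>With \<open>K\<close> the sum of all absolute entries, every absolute row sum is at most
  \<open>K\<close>, so entries of the \<open>n\<close>-th power are at most \<open>K ^ n\<close> and
  the scalar exponential series dominates. Absolute summability is what the Cauchy product
  requires.\<close>

lemma summable_matpow_entry:
  fixes A :: "real^'m::finite^'m"
  shows "summable (\<lambda>n. norm ((1 / fact n) * matpow A n $ i $ j))"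
proof -
  define K where "K = (\<Sum>i\<in>UNIV. \<Sum>j\<in>UNIV. \<bar>A $ i $ j\<bar>)"
  have row: "(\<Sum>k\<in>UNIV. \<bar>A $ i $ k\<bar>) \<le> K" for i
    unfolding K_def
    by (rule member_le_sum[of i UNIV "\<lambda>i. \<Sum>j\<in>UNIV. \<bar>A $ i $ j\<bar>"]) (auto intro: sum_nonneg)
  have K: "K \<ge> 0" by (auto simp: K_def intro!: sum_nonneg)
  have bound: "\<bar>matpow A n $ i $ j\<bar> \<le> K ^ n" for n i
  proof (induction n arbitrary: i)
    case (Suc n)
    have "\<bar>matpow A (Suc n) $ i $ j\<bar> \<le> (\<Sum>k\<in>UNIV. \<bar>A $ i $ k\<bar> * \<bar>matpow A n $ k $ j\<bar>)"
      by (simp add: matrix_matrix_mult_def abs_mult[symmetric])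
    also have "\<dots> \<le> (\<Sum>k\<in>UNIV. \<bar>A $ i $ k\<bar> * K ^ n)"
      by (intro sum_mono mult_left_mono Suc) auto
    also have "\<dots> = (\<Sum>k\<in>UNIV. \<bar>A $ i $ k\<bar>) * K ^ n" by (simp add: sum_distrib_right)
    also have "\<dots> \<le> K * K ^ n" using row K by (intro mult_right_mono) auto
    finally show ?case by simp
  qed (simp add: mat_def)
  have "summable (\<lambda>n. inverse (fact n) * K ^ n)" by (rule summable_exp)
  then show ?thesis
    by (rule summable_comparison_test') (use bound in \<open>auto simp: abs_mult field_simps intro!: divide_right_mono\<close>)
qed

lemma mexp_entry:
  fixes A :: "real^'m::finite^'m"
  shows "mexp A $ i $ j = (\<Sum>n. (1 / fact n) * matpow A n $ i $ j)"
proof -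
  let ?f = "\<lambda>n. (1 / fact n) *\<^sub>R matpow A n"
  have "(\<lambda>n. (1 / fact n) * matpow A n $ i $ j) sums (\<Sum>n. (1 / fact n) * matpow A n $ i $ j)" for i j
    by (intro summable_sums summable_norm_cancel[OF summable_matpow_entry])
  then have "?f sums (\<chi> i j. \<Sum>n. (1 / fact n) * matpow A n $ i $ j)"
    unfolding sums_def by (intro vec_tendstoI) simp
  then have "mexp A = (\<chi> i j. \<Sum>n. (1 / fact n) * matpow A n $ i $ j)"
    unfolding mexp_def by (rule sums_unique[symmetric])
  then show ?thesis by simp
qed

lemma matpow_add: "matpow A m ** matpow A n = matpow A (m + n)"
  by (induction m) (simp_all add: matrix_mul_assoc[symmetric])

lemma matpow_uminus: "matpow (- A) n = (-1) ^ n *\<^sub>R matpow A n"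
  by (induction n) (simp_all add: vec_eq_iff matrix_matrix_mult_def sum_distrib_left sum_negf mult.left_commute)

text \<open>The coefficient of order \<open>n\<close> in the entrywise Cauchy product is
  \<open>(1 - 1) ^ n\<close> times an entry of \<open>matpow A n / fact n\<close>, so only
  \<open>n = 0\<close> survives. Applied to a matrix and its negative, this gives a two-sided
  inverse of the flow.\<close>

lemma mexp_mult_uminus:
  fixes A :: "real^'m::finite^'m"
  shows "mexp A ** mexp (- A) = mat 1"
proof -
  let ?a = "\<lambda>n i j. (1 / fact n) * matpow A n $ i $ j"
  let ?b = "\<lambda>n i j. (1 / fact n) * matpow (- A) n $ i $ j"
  have coeff: "(\<Sum>m\<le>n. \<Sum>k\<in>UNIV. ?a m i k * ?b (n - m) k j) = (if n = 0 then mat 1 $ i $ j else 0)"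
    for n i j
  proof -
    have "(\<Sum>k\<in>UNIV. ?a m i k * ?b (n - m) k j)
        = of_nat (n choose m) * (-1) ^ (n - m) * (matpow A n $ i $ j / fact n)" if "m \<le> n" for m
    proof -
      have "(\<Sum>k\<in>UNIV. ?a m i k * ?b (n - m) k j)
          = (-1) ^ (n - m) / (fact m * fact (n - m)) * (\<Sum>k\<in>UNIV. matpow A m $ i $ k * matpow A (n - m) $ k $ j)"
        by (simp add: matpow_uminus sum_distrib_left field_simps)
      also have "(\<Sum>k\<in>UNIV. matpow A m $ i $ k * matpow A (n - m) $ k $ j) = matpow A n $ i $ j"
        using matpow_add[of A m "n - m"] that by (simp add: matrix_matrix_mult_def vec_eq_iff)
      finally show ?thesis using that by (simp add: binomial_fact field_simps)
    qed
    then have "(\<Sum>m\<le>n. \<Sum>k\<in>UNIV. ?a m i k * ?b (n - m) k j)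
        = (\<Sum>m\<le>n. of_nat (n choose m) * 1 ^ m * (-1) ^ (n - m)) * (matpow A n $ i $ j / fact n)"
      unfolding sum_distrib_right by (intro sum.cong) auto
    also have "(\<Sum>m\<le>n. of_nat (n choose m) * 1 ^ m * (-1) ^ (n - m)) = (1 + (-1 :: real)) ^ n"
      by (rule binomial_ring[symmetric])
    finally show ?thesis by (cases n) simp_all
  qed
  have "(mexp A ** mexp (- A)) $ i $ j = mat 1 $ i $ j" for i j
  proof -
    have prod: "(\<lambda>n. \<Sum>k\<in>UNIV. \<Sum>m\<le>n. ?a m i k * ?b (n - m) k j) sums
        (\<Sum>k\<in>UNIV. mexp A $ i $ k * mexp (- A) $ k $ j)"
      unfolding mexp_entry by (intro sums_sum Cauchy_product_sums summable_matpow_entry)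
    have const: "(\<lambda>n. \<Sum>k\<in>UNIV. \<Sum>m\<le>n. ?a m i k * ?b (n - m) k j) = (\<lambda>n. if n = 0 then mat 1 $ i $ j else 0)"
      by (subst sum.swap) (simp only: coeff)
    have sing: "(\<lambda>n. if n = 0 then mat 1 $ i $ j else 0) sums (mat 1 $ i $ j :: real)"
      using sums_single[of 0 "\<lambda>_. mat 1 $ i $ j :: real"] by simp
    have "(\<Sum>k\<in>UNIV. mexp A $ i $ k * mexp (- A) $ k $ j) = mat 1 $ i $ j"
      by (rule sums_unique2[OF prod[unfolded const] sing])
    then show ?thesis by (simp add: matrix_matrix_mult_def)
  qed
  then show ?thesis by (simp add: vec_eq_iff)
qed

lemma invertible_symp_flow: "invertible (symp_flow MM t)"
  unfolding symp_flow_def invertible_def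
  using mexp_mult_uminus[of "t *\<^sub>R (Jmat ** MM)"] mexp_mult_uminus[of "- (t *\<^sub>R (Jmat ** MM))"]
  by auto

lemma matrix_inv_mult_vec: "invertible S \<Longrightarrow> matrix_inv S *v (S *v (z::real^'m::finite)) = z"
  unfolding invertible_def matrix_vector_mul_assoc matrix_inv_def
  by (drule someI_ex) simp

lemma ppos_pjoin [simp]: "ppos (pjoin x \<xi>) = x"
  and pmom_pjoin [simp]: "pmom (pjoin x \<xi>) = \<xi>"
  by (simp_all add: ppos_def pmom_def pjoin_def)

text \<open>This is where the block \<open>B\<close> enters: a line in frequency for the initial
  datum becomes a line in position at the later time, where the second Gaussian bound acts.\<close>

lemma ppos_mult_pjoin_shift:
  "ppos (S *v pjoin x (\<xi> + s *\<^sub>R v)) = ppos (S *v pjoin x \<xi>) + s *\<^sub>R (ublock S *v v)"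
proof -
  have *: "(\<Sum>k\<in>UNIV. g k) = (\<Sum>i\<in>UNIV. g (Inl i)) + (\<Sum>i\<in>UNIV. g (Inr i))" for g :: "'a + 'a \<Rightarrow> real"
    by (simp add: UNIV_Plus_UNIV[symmetric] sum.Plus del: UNIV_Plus_UNIV)
  show ?thesis
    by (simp add: vec_eq_iff ppos_def pjoin_def ublock_def matrix_vector_mult_def * sum.distrib
        sum_distrib_left algebra_simps)
qed

section \<open>Gaussian integrals and Fourier injectivity\<close>

lemma integral_lborel_affine:
  fixes f :: "'a::euclidean_space \<Rightarrow> 'b::{banach, second_countable_topology}"
  assumes f [measurable]: "f \<in> borel_measurable borel" and c: "c \<noteq> 0"
  shows "(LINT x|lborel. f x) = \<bar>c\<bar> ^ DIM('a) *\<^sub>R (LINT x|lborel. f (t + c *\<^sub>R x))"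
  by (subst lborel_affine[OF c, of t]) (simp add: integral_density integral_distr)

lemma integrable_lborel_affine:
  fixes f :: "'a::euclidean_space \<Rightarrow> 'b::{banach, second_countable_topology}"
  assumes f: "integrable lborel f" and c: "c \<noteq> 0"
  shows "integrable lborel (\<lambda>x. f (t + c *\<^sub>R x))"
proof -
  have [measurable]: "f \<in> borel_measurable borel" using borel_measurable_integrable[OF f] by simp
  have "integrable (density (distr lborel borel (\<lambda>x. t + c *\<^sub>R x)) (\<lambda>_. ennreal (\<bar>c\<bar> ^ DIM('a)))) f"
    using f lborel_affine[OF c, of t] by (simp add: ennreal_power)
  then have "integrable lborel (\<lambda>x. \<bar>c\<bar> ^ DIM('a) *\<^sub>R f (t + c *\<^sub>R x))"
    by (simp add: integrable_density integrable_distr_eq)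
  then have "integrable lborel (\<lambda>x. (1 / \<bar>c\<bar> ^ DIM('a)) *\<^sub>R (\<bar>c\<bar> ^ DIM('a) *\<^sub>R f (t + c *\<^sub>R x)))"
    by (rule integrable_scaleR_right)
  then show ?thesis using c by simp
qed

text \<open>The evolved state is bounded only almost everywhere, and its Wigner integrand evaluates
  it at \<open>x + t / 2\<close> and \<open>x - t / 2\<close>; null sets must be pulled back along
  both maps, hence the possibly negative factor.\<close>

lemma AE_lborel_affine:
  fixes P :: "'a::euclidean_space \<Rightarrow> bool"
  assumes P: "AE x in lborel. P x" and c: "c \<noteq> 0"
  shows "AE x in lborel. P (t + c *\<^sub>R x)"
proof -
  obtain N where N: "{x. \<not> P x} \<subseteq> N" "N \<in> sets borel" "emeasure lborel N = 0"
    using AE_E[OF P] by auto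
  have NN: "AE x in lborel. x \<notin> N"
    using N AE_not_in[of N lborel] by (simp add: null_sets_def)
  then have "AE x in density (distr lborel borel (\<lambda>x. t + c *\<^sub>R x)) (\<lambda>_. ennreal (\<bar>c\<bar> ^ DIM('a))). x \<notin> N"
    using lborel_affine[OF c, of t] by metis
  then have "AE x in distr lborel borel (\<lambda>x. t + c *\<^sub>R x). x \<notin> N"
    using c by (subst (asm) AE_density) (auto simp: ennreal_eq_0_iff)
  then have "AE x in lborel. t + c *\<^sub>R x \<notin> N"
    using N by (subst (asm) AE_distr_iff) auto
  then show ?thesis by eventually_elim (use N in auto)
qed

text \<open>Lebesgue measure is the image of the product of its one-dimensional copies over
  \<open>Basis\<close>, which reduces Gaussian integrals to one variable.\<close>

lemma
  fixes f :: "'a::euclidean_space \<Rightarrow> real \<Rightarrow> 'b::{real_normed_field, banach, second_countable_topology}"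
  assumes f: "\<And>b. b \<in> Basis \<Longrightarrow> integrable lborel (f b)"
  shows integrable_lborel_prod: "integrable lborel (\<lambda>x. \<Prod>b\<in>Basis. f b (x \<bullet> b))"
    and integral_lborel_prod:
      "(LINT x|lborel. (\<Prod>b\<in>Basis. f b (x \<bullet> b))) = (\<Prod>b\<in>Basis. LINT y|lborel. f b y)"
proof -
  interpret product_sigma_finite "\<lambda>_::'a. lborel :: real measure" by standard
  have [measurable]: "f b \<in> borel_measurable borel" if "b \<in> Basis" for b
    using borel_measurable_integrable[OF f[OF that]] by simp
  have "integrable (\<Pi>\<^sub>M b\<in>Basis. lborel) (\<lambda>x. \<Prod>b\<in>Basis. f b (x b))"
    by (intro product_integrable_prod f) auto
  then show "integrable lborel (\<lambda>x. \<Prod>b\<in>Basis. f b (x \<bullet> b))"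
    by (subst lborel_eq) (simp add: integrable_distr_eq inner_sum_left inner_Basis if_distrib sum.delta cong: if_cong)
  have "(\<integral>x. (\<Prod>b\<in>Basis. f b (x b)) \<partial>(\<Pi>\<^sub>M b\<in>Basis. lborel)) = (\<Prod>b\<in>Basis. LINT y|lborel. f b y)"
    by (intro product_integral_prod f) auto
  then show "(LINT x|lborel. (\<Prod>b\<in>Basis. f b (x \<bullet> b))) = (\<Prod>b\<in>Basis. LINT y|lborel. f b y)"
    by (subst lborel_eq) (simp add: integral_distr)
qed

lemma integrable_std_normal_density: "integrable lborel std_normal_density"
  using integrable_std_normal_moment[of 0] by simp

lemma exp_norm_square_eq_prod:
  fixes x :: "'a::euclidean_space"
  shows "exp (k * (norm x)\<^sup>2) = (\<Prod>b\<in>Basis. exp (k * (x \<bullet> b)\<^sup>2))"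
  unfolding power2_norm_eq_inner euclidean_inner[of x x]
  by (simp add: exp_sum sum_distrib_left power2_eq_square)

lemma integrable_exp_norm_square:
  assumes k: "0 < k"
  shows "integrable lborel (\<lambda>x::'a::euclidean_space. exp (- k * (norm x)\<^sup>2))"
proof -
  have "integrable lborel (\<lambda>x. exp (- k * x\<^sup>2))"
  proof -
    \<comment> \<open>The variance \<open>1 / (2 * k)\<close> gives the exponent
      \<open>- k * x\<^sup>2\<close>, and the square root undoes the normalisation of the
      density.\<close>
    have "integrable lborel (\<lambda>x. sqrt (2 * pi * (1 / sqrt (2 * k))\<^sup>2) * normal_density 0 (1 / sqrt (2 * k)) x)"
      using integrable_normal_moment[of "1 / sqrt (2 * k)" 0 0] k by (intro integrable_mult_right) simp
    then show ?thesis using k by (simp add: normal_density_def power_divide mult.commute)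
  qed
  then show ?thesis
    unfolding exp_norm_square_eq_prod by (rule integrable_lborel_prod)
qed

text \<open>The integrand factorises over coordinates into characteristic functions of the standard
  normal law.\<close>

lemma gaussian_fourier:
  fixes t :: "'a::euclidean_space"
  shows "(LINT \<xi>|lborel. of_real (\<Prod>b\<in>Basis. std_normal_density (\<xi> \<bullet> b)) * iexp (\<xi> \<bullet> t))
    = complex_of_real (exp (- (norm t)\<^sup>2 / 2))"
proof -
  have one: "integrable lborel (\<lambda>x. of_real (std_normal_density x) * iexp (x * s))"
    "(LINT x|lborel. of_real (std_normal_density x) * iexp (x * s)) = of_real (exp (- s\<^sup>2 / 2))" for s :: real
  proof -
    show "integrable lborel (\<lambda>x. of_real (std_normal_density x) * iexp (x * s))"
      by (rule Bochner_Integration.integrable_bound[OF integrable_std_normal_density]) (auto simp: norm_mult)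
    have "char std_normal_distribution s = (LINT x|lborel. std_normal_density x *\<^sub>R iexp (s * x))"
      unfolding char_def by (subst integral_density) auto
    then show "(LINT x|lborel. of_real (std_normal_density x) * iexp (x * s)) = of_real (exp (- s\<^sup>2 / 2))"
      by (simp add: char_std_normal_distribution scaleR_conv_of_real mult.commute)
  qed
  have "of_real (\<Prod>b\<in>Basis. std_normal_density (\<xi> \<bullet> b)) * iexp (\<xi> \<bullet> t)
      = (\<Prod>b\<in>Basis. of_real (std_normal_density (\<xi> \<bullet> b)) * iexp ((\<xi> \<bullet> b) * (t \<bullet> b)))" for \<xi> :: 'a
    by (subst euclidean_inner) (simp add: prod.distrib exp_sum sum_distrib_left)
  then have "(LINT \<xi>|lborel. of_real (\<Prod>b\<in>Basis. std_normal_density (\<xi> \<bullet> b)) * iexp (\<xi> \<bullet> t))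
      = (LINT \<xi>|lborel. (\<Prod>b\<in>Basis. of_real (std_normal_density (\<xi> \<bullet> b)) * iexp ((\<xi> \<bullet> b) * (t \<bullet> b))))"
    by (simp only:)
  also have "\<dots> = (\<Prod>b\<in>Basis. LINT y|lborel. of_real (std_normal_density y) * iexp (y * (t \<bullet> b)))"
    by (rule integral_lborel_prod[OF one(1)])
  also have "\<dots> = (\<Prod>b\<in>Basis. of_real (exp (- (t \<bullet> b)\<^sup>2 / 2)))"
    by (simp only: one(2))
  also have "\<dots> = complex_of_real (exp (- (norm t)\<^sup>2 / 2))"
    using exp_norm_square_eq_prod[of "- 1 / 2" t] by simp
  finally show ?thesis .
qed

text \<open>Integrating the Fourier transform against a Gaussian, then rescaling, evaluates \<open>g\<close> at the origin.\<close>
lemma fourier_zero_imp_zero: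
  fixes g :: "'a::euclidean_space \<Rightarrow> complex"
  assumes int: "integrable lborel g" and cont: "continuous_on UNIV g"
    and bdd: "\<And>t. cmod (g t) \<le> C"
    and zero: "\<And>\<xi>. (LINT t|lborel. g t * iexp (\<xi> \<bullet> t)) = 0"
  shows "g 0 = 0"
proof -
  have [measurable]: "g \<in> borel_measurable borel" using cont by (rule borel_measurable_continuous_onI)
  define \<gamma> where "\<gamma> = (\<lambda>\<xi>::'a. \<Prod>b\<in>Basis. std_normal_density (\<xi> \<bullet> b))"
  have \<gamma>: "integrable lborel \<gamma>"
    unfolding \<gamma>_def by (intro integrable_lborel_prod integrable_std_normal_density)
  have [measurable]: "\<gamma> \<in> borel_measurable borel" using borel_measurable_integrable[OF \<gamma>] by simp
  have [simp]: "0 \<le> \<gamma> \<xi>" for \<xi>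
    unfolding \<gamma>_def by (intro prod_nonneg normal_density_nonneg)
  \<comment> \<open>The vanishing transform at frequency \<open>r *\<^sub>R \<xi>\<close> is
    averaged against \<open>\<gamma>\<close>. Fubini moves the average onto the exponential, turning
    it into a Gaussian in \<open>r *\<^sub>R t\<close>.\<close>
  have smooth0: "(LINT t|lborel. g t * of_real (exp (- (r * norm t)\<^sup>2 / 2))) = 0" for r :: real
  proof -
    let ?F = "\<lambda>\<xi> t. of_real (\<gamma> \<xi>) * iexp (\<xi> \<bullet> (r *\<^sub>R t)) * g t"
    have "integrable (lborel \<Otimes>\<^sub>M lborel) (case_prod ?F)"
    proof (rule lborel_pair.Fubini_integrable)
      have "(\<lambda>\<xi>. LINT t|lborel. cmod (?F \<xi> t)) = (\<lambda>\<xi>. \<gamma> \<xi> * (LINT t|lborel. cmod (g t)))"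
        by (simp add: norm_mult)
      then show "integrable lborel (\<lambda>\<xi>. LINT t|lborel. cmod (case_prod ?F (\<xi>, t)))"
        using \<gamma> by simp
      have "integrable lborel (\<lambda>t. ?F \<xi> t)" for \<xi>
        by (rule Bochner_Integration.integrable_bound[OF integrable_mult_right[OF int, of "of_real (\<gamma> \<xi>)"]])
          (auto simp: norm_mult)
      then show "AE \<xi> in lborel. integrable lborel (\<lambda>t. case_prod ?F (\<xi>, t))" by simp
    qed simp
    then have "(LINT t|lborel. LINT \<xi>|lborel. ?F \<xi> t) = (LINT \<xi>|lborel. LINT t|lborel. ?F \<xi> t)"
      by (rule lborel_pair.Fubini_integral)
    also have "(\<lambda>\<xi>. LINT t|lborel. ?F \<xi> t) = (\<lambda>\<xi>. of_real (\<gamma> \<xi>) * (LINT t|lborel. g t * iexp ((r *\<^sub>R \<xi>) \<bullet> t)))"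
      by (subst integral_mult_right_zero[symmetric]) (simp add: mult_ac)
    also have "\<dots> = (\<lambda>_. 0)" by (simp only: zero mult_zero_right)
    also have "(\<lambda>t. LINT \<xi>|lborel. ?F \<xi> t) = (\<lambda>t. g t * of_real (exp (- (r * norm t)\<^sup>2 / 2)))"
    proof
      fix t
      have "(LINT \<xi>|lborel. ?F \<xi> t) = (LINT \<xi>|lborel. of_real (\<gamma> \<xi>) * iexp (\<xi> \<bullet> (r *\<^sub>R t))) * g t"
        by (rule integral_mult_left_zero)
      also have "\<dots> = of_real (exp (- (norm (r *\<^sub>R t))\<^sup>2 / 2)) * g t"
        unfolding \<gamma>_def by (simp only: gaussian_fourier)
      finally show "(LINT \<xi>|lborel. ?F \<xi> t) = g t * of_real (exp (- (r * norm t)\<^sup>2 / 2))"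
        by (simp add: power_mult_distrib mult.commute)
    qed
    finally show ?thesis by simp
  qed
  let ?e = "\<lambda>t::'a. exp (- (norm t)\<^sup>2 / 2)"
  have e_int: "integrable lborel ?e" using integrable_exp_norm_square[of "1 / 2"] by simp
  \<comment> \<open>Substitution moves the dilation from the Gaussian to \<open>g\<close>;
    \<open>Suc n\<close> keeps the factor nonzero.\<close>
  have scaled0: "(LINT t|lborel. g ((1 / real (Suc n)) *\<^sub>R t) * of_real (?e t)) = 0" for n
  proof -
    let ?f = "\<lambda>t. g t * of_real (exp (- (real (Suc n) * norm t)\<^sup>2 / 2))"
    have "0 = \<bar>1 / real (Suc n)\<bar> ^ DIM('a) *\<^sub>R (LINT t|lborel. ?f (0 + (1 / real (Suc n)) *\<^sub>R t))"
      unfolding smooth0[symmetric, of "real (Suc n)"] by (rule integral_lborel_affine) auto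
    moreover have "?f (0 + (1 / real (Suc n)) *\<^sub>R t) = g ((1 / real (Suc n)) *\<^sub>R t) * of_real (?e t)" for t
    proof -
      have "real (Suc n) * norm ((1 / real (Suc n)) *\<^sub>R t) = norm t" by (simp del: of_nat_Suc)
      then show ?thesis by (simp only: add_0)
    qed
    ultimately show ?thesis by simp
  qed
  \<comment> \<open>As the dilations shrink, continuity sends \<open>g\<close> to its value at the
    origin, with domination by \<open>C * ?e t\<close>.\<close>
  have "(\<lambda>n. LINT t|lborel. g ((1 / real (Suc n)) *\<^sub>R t) * of_real (?e t)) \<longlonglongrightarrow> (LINT t|lborel. g 0 * of_real (?e t))"
  proof (rule integral_dominated_convergence)
    show "integrable lborel (\<lambda>t. C * ?e t)" using e_int by simp
    show "AE t in lborel. (\<lambda>n. g ((1 / real (Suc n)) *\<^sub>R t) * of_real (?e t)) \<longlonglongrightarrow> g 0 * of_real (?e t)"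
    proof (intro AE_I2 tendsto_mult_right)
      fix t :: 'a
      have "(\<lambda>n. (1 / real (Suc n)) *\<^sub>R t) \<longlonglongrightarrow> 0 *\<^sub>R t"
        using LIMSEQ_inverse_real_of_nat by (intro tendsto_scaleR tendsto_const) (simp add: inverse_eq_divide)
      then show "(\<lambda>n. g ((1 / real (Suc n)) *\<^sub>R t)) \<longlonglongrightarrow> g 0"
        using continuous_on_tendsto_compose[OF cont] by simp
    qed
    show "AE t in lborel. cmod (g ((1 / real (Suc n)) *\<^sub>R t) * of_real (?e t)) \<le> C * ?e t" for n
      using bdd by (auto simp: norm_mult intro!: mult_right_mono)
  qed auto
  then have "g 0 * of_real (LINT t|lborel. ?e t) = 0"
    by (simp only: scaled0 LIMSEQ_const_iff integral_mult_right_zero integral_complex_of_real)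
  moreover have "(LINT t|lborel. ?e t) \<noteq> 0"
  proof
    assume "(LINT t|lborel. ?e t) = 0"
    then have "AE t in lborel. ?e t = 0"
      using integral_nonneg_eq_0_iff_AE[OF e_int] by simp
    then have "ae_filter (lborel :: 'a measure) = bot" by (simp add: trivial_limit_def)
    then show False by (simp add: Measure_Space.ae_filter_eq_bot_iff)
  qed
  ultimately show ?thesis by simp
qed

text \<open>Expanding the exponential and integrating termwise yields a power series convergent
  everywhere. The absolute partial sums are dominated by
  \<open>cmod (f t) * exp (cmod z * \<bar>a t\<bar>)\<close>, integrable by the hypothesis with
  \<open>r = cmod z\<close>.\<close>

lemma holomorphic_laplace_transform:
  fixes f :: "'a \<Rightarrow> complex" and a :: "'a \<Rightarrow> real"
  assumes [measurable]: "f \<in> borel_measurable M" "a \<in> borel_measurable M"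
    and int: "\<And>r. integrable M (\<lambda>t. cmod (f t) * exp (r * \<bar>a t\<bar>))"
  shows "(\<lambda>z. LINT t|M. f t * exp (z * of_real (a t))) holomorphic_on UNIV"
proof -
  have series: "(\<lambda>n. (LINT t|M. f t * of_real (a t) ^ n / fact n) * (z - 0) ^ n) sums
      (LINT t|M. f t * exp (z * of_real (a t)))" for z
  proof -
    let ?F = "\<lambda>n t. f t * (z * of_real (a t)) ^ n /\<^sub>R fact n"
    have norm_F: "cmod (?F n t) = cmod (f t) * ((cmod z * \<bar>a t\<bar>) ^ n /\<^sub>R fact n)" for n t
      by (simp add: norm_mult norm_power norm_divide)
    have exp_sums: "(\<lambda>n. cmod (?F n t)) sums (cmod (f t) * exp (cmod z * \<bar>a t\<bar>))" for t
      unfolding norm_F by (intro sums_mult exp_converges)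
    have part: "(\<Sum>n<N. cmod (?F n t)) \<le> cmod (f t) * exp (cmod z * \<bar>a t\<bar>)" for N t
      using exp_sums[of t] sum_le_suminf[of "\<lambda>n. cmod (?F n t)" "{..<N}"] by (auto simp: sums_iff)
    have F_int: "integrable M (?F n)" for n
    proof (rule Bochner_Integration.integrable_bound[OF int[of "cmod z"]])
      have "cmod (?F n t) \<le> cmod (f t) * exp (cmod z * \<bar>a t\<bar>)" for t
        by (rule order_trans[OF member_le_sum[of n "{..<Suc n}" "\<lambda>n. cmod (?F n t)"] part]) auto
      then show "AE t in M. cmod (?F n t) \<le> norm (cmod (f t) * exp (cmod z * \<bar>a t\<bar>))"
        by (intro AE_I2) (simp only: real_norm_def abs_mult abs_norm_cancel abs_exp_cancel)
    qed simp
    have "(\<lambda>n. integral\<^sup>L M (?F n)) sums (LINT t|M. (\<Sum>n. ?F n t))"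
    proof (rule sums_integral)
      show "AE t in M. summable (\<lambda>n. cmod (?F n t))"
        using exp_sums by (intro AE_I2) (auto simp: sums_iff)
      show "summable (\<lambda>n. LINT t|M. cmod (?F n t))"
      proof (rule summableI_nonneg_bounded)
        fix N
        have "(\<Sum>n<N. LINT t|M. cmod (?F n t)) = (LINT t|M. (\<Sum>n<N. cmod (?F n t)))"
          by (rule Bochner_Integration.integral_sum[symmetric]) (intro integrable_norm F_int)
        also have "\<dots> \<le> (LINT t|M. cmod (f t) * exp (cmod z * \<bar>a t\<bar>))"
          by (intro integral_mono part int Bochner_Integration.integrable_sum integrable_norm F_int)
        finally show "(\<Sum>n<N. LINT t|M. cmod (?F n t)) \<le> (LINT t|M. cmod (f t) * exp (cmod z * \<bar>a t\<bar>))" .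
      qed auto
    qed (rule F_int)
    moreover have "(\<Sum>n. ?F n t) = f t * exp (z * of_real (a t))" for t
    proof -
      have "(\<lambda>n. f t * ((z * of_real (a t)) ^ n /\<^sub>R fact n)) sums (f t * exp (z * of_real (a t)))"
        by (intro sums_mult exp_converges)
      then show ?thesis by (simp add: sums_iff)
    qed
    moreover have "integral\<^sup>L M (?F n) = (LINT t|M. f t * of_real (a t) ^ n / fact n) * (z - 0) ^ n" for n
      by (subst integral_mult_left_zero[symmetric])
        (simp add: power_mult_distrib scaleR_conv_of_real field_simps)
    ultimately show ?thesis by simp
  qed
  have "(\<lambda>z. LINT t|M. f t * exp (z * of_real (a t))) holomorphic_on ball 0 r" for r
    by (rule power_series_holomorphic[OF series])
  then have "(\<lambda>z. LINT t|M. f t * exp (z * of_real (a t))) holomorphic_on (\<Union>r. ball 0 r)"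
    by (intro holomorphic_on_UN_open) auto
  moreover have "(\<Union>r. ball 0 r) = (UNIV :: complex set)"
    by (auto intro: gt_ex)
  ultimately show ?thesis by simp
qed

text \<open>The form attains a positive minimum on the compact unit sphere, and homogeneity of
  degree two extends the bound to all vectors.\<close>

lemma sym_pos_def_coercive:
  assumes "sym_pos_def (M :: real^'n::finite^'n)"
  obtains m where "m > 0" "\<And>x. m * (norm x)\<^sup>2 \<le> (M *v x) \<bullet> x"
proof -
  have "continuous_on (sphere 0 1) (\<lambda>x. (M *v x) \<bullet> x)" by (intro continuous_intros)
  then obtain y where y: "y \<in> sphere 0 1" "\<forall>x \<in> sphere 0 1. (M *v y) \<bullet> y \<le> (M *v x) \<bullet> x"
    using continuous_attains_inf[of "sphere 0 1" "\<lambda>x. (M *v x) \<bullet> x"] by auto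
  show thesis
  proof
    have "y \<noteq> 0" using y(1) by auto
    then show "(M *v y) \<bullet> y > 0" using assms by (simp add: sym_pos_def_def inner_commute)
    fix x :: "real^'n"
    show "(M *v y) \<bullet> y * (norm x)\<^sup>2 \<le> (M *v x) \<bullet> x"
    proof (cases "x = 0")
      case False
      then have "(M *v y) \<bullet> y \<le> (M *v (x /\<^sub>R norm x)) \<bullet> (x /\<^sub>R norm x)"
        by (intro y(2)[rule_format]) auto
      also have "\<dots> = (M *v x) \<bullet> x / (norm x)\<^sup>2"
        by (simp add: matrix_vector_mult_scaleR power2_eq_square divide_inverse mult_ac)
      finally show ?thesis using False by (simp add: field_simps)
    qed simp
  qed
qed

section \<open>Wigner distributions under Gaussian bounds\<close>

text \<open>Wigner covariance is asserted for square-integrable representatives, so this membership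
  precedes its use for the initial datum.\<close>

lemma sq_int_gaussian_bound:
  fixes f :: "real^'n::finite \<Rightarrow> complex"
  assumes [measurable]: "f \<in> borel_measurable borel" and M: "sym_pos_def M"
    and bound: "\<And>x. cmod (f x) \<le> c * exp (- pi * ((M *v x) \<bullet> x))"
  shows "sq_int f"
proof -
  obtain m where m: "m > 0" "\<And>x. m * (norm x)\<^sup>2 \<le> (M *v x) \<bullet> x"
    using sym_pos_def_coercive[OF M] by blast
  have c: "0 \<le> c" using order_trans[OF norm_ge_zero bound[of 0]] by simp
  have "integrable lborel (\<lambda>x. (cmod (f x))\<^sup>2)"
  proof (rule Bochner_Integration.integrable_bound)
    show "integrable lborel (\<lambda>x::real^'n. c\<^sup>2 * exp (- (2 * pi * m) * (norm x)\<^sup>2))"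
      using m(1) by (intro integrable_mult_right integrable_exp_norm_square) simp
    have "(cmod (f x))\<^sup>2 \<le> c\<^sup>2 * exp (- (2 * pi * m) * (norm x)\<^sup>2)" for x
    proof -
      have "(cmod (f x))\<^sup>2 \<le> (c * exp (- pi * ((M *v x) \<bullet> x)))\<^sup>2"
        by (intro power_mono bound) auto
      also have "\<dots> = c\<^sup>2 * exp (- (2 * pi) * ((M *v x) \<bullet> x))"
        by (simp add: power_mult_distrib flip: exp_double)
      also have "\<dots> \<le> c\<^sup>2 * exp (- (2 * pi) * (m * (norm x)\<^sup>2))"
        using m(2)[of x] by (intro mult_left_mono) auto
      finally show ?thesis by (simp add: mult.assoc)
    qed
    then show "AE x in lborel. norm ((cmod (f x))\<^sup>2) \<le> norm (c\<^sup>2 * exp (- (2 * pi * m) * (norm x)\<^sup>2))"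
      by (intro AE_I2) simp
  qed simp
  then show ?thesis by (simp add: sq_int_def)
qed

lemma sym_pos_def_symmetric: "sym_pos_def M \<Longrightarrow> (M *v x) \<bullet> y = x \<bullet> (M *v y)"
  by (metis dot_lmul_matrix sym_pos_def_def vector_transpose_matrix)

lemma borel_measurable_quadratic_form [measurable]:
  "(\<lambda>t::real^'n::finite. (M *v t) \<bullet> t) \<in> borel_measurable borel"
  by (intro borel_measurable_continuous_onI continuous_intros)

lemma borel_measurable_cnj [measurable]: "cnj \<in> borel_measurable borel"
  by (intro borel_measurable_continuous_onI continuous_intros)

text \<open>The cross terms cancel, so the Gaussian bound of a Wigner integrand splits into a factor
  in the base point \<open>x\<close> and a factor in the integration variable
  \<open>t\<close>.\<close>

lemma parallelogram_form:
  fixes M :: "real^'n::finite^'n"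
  shows "(M *v (x + (1/2) *\<^sub>R t)) \<bullet> (x + (1/2) *\<^sub>R t) + (M *v (x - (1/2) *\<^sub>R t)) \<bullet> (x - (1/2) *\<^sub>R t)
    = 2 * ((M *v x) \<bullet> x) + (M *v t) \<bullet> t / 2"
  by (simp add: algebra_simps matrix_vector_right_distrib matrix_vector_mult_diff_distrib
      inner_add_left inner_add_right inner_diff_left inner_diff_right matrix_vector_mult_scaleR)

text \<open>Phrased for two complex values instead of a function, so that it serves pointwise and
  almost-everywhere bounds alike.\<close>

lemma gaussian_product_bound:
  fixes M :: "real^'n::finite^'n" and p q :: complex
  assumes "cmod p \<le> c * exp (- pi * ((M *v (x + (1/2) *\<^sub>R t)) \<bullet> (x + (1/2) *\<^sub>R t)))"
    and "cmod q \<le> c * exp (- pi * ((M *v (x - (1/2) *\<^sub>R t)) \<bullet> (x - (1/2) *\<^sub>R t)))"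
  shows "cmod (p * cnj q) \<le> c\<^sup>2 * exp (- 2 * pi * ((M *v x) \<bullet> x)) * exp (- (pi / 2) * ((M *v t) \<bullet> t))"
proof -
  have "cmod (p * cnj q) \<le> (c * exp (- pi * ((M *v (x + (1/2) *\<^sub>R t)) \<bullet> (x + (1/2) *\<^sub>R t))))
      * (c * exp (- pi * ((M *v (x - (1/2) *\<^sub>R t)) \<bullet> (x - (1/2) *\<^sub>R t))))"
    unfolding norm_mult complex_mod_cnj using assms by (intro mult_mono order_trans[OF norm_ge_zero assms(1)]) auto
  also have "\<dots> = c\<^sup>2 * exp (- pi * ((M *v (x + (1/2) *\<^sub>R t)) \<bullet> (x + (1/2) *\<^sub>R t)
        + (M *v (x - (1/2) *\<^sub>R t)) \<bullet> (x - (1/2) *\<^sub>R t)))"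
    by (simp add: power2_eq_square distrib_left flip: exp_add)
  also have "\<dots> = c\<^sup>2 * exp (- 2 * pi * ((M *v x) \<bullet> x)) * exp (- (pi / 2) * ((M *v t) \<bullet> t))"
    unfolding parallelogram_form by (simp add: algebra_simps flip: exp_add)
  finally show ?thesis .
qed

lemma integrable_gaussian_form:
  fixes M :: "real^'n::finite^'n"
  assumes M: "sym_pos_def M" and k: "0 < k"
  shows "integrable lborel (\<lambda>t. exp (- k * ((M *v t) \<bullet> t) + r * \<bar>v \<bullet> t\<bar>))"
proof -
  obtain m where m: "m > 0" "\<And>x. m * (norm x)\<^sup>2 \<le> (M *v x) \<bullet> x"
    using sym_pos_def_coercive[OF M] by blast
  \<comment> \<open>Coercivity supplies \<open>2 * K * (norm t)\<^sup>2\<close>. One half absorbs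
    the linear term by completing the square; the other remains as an integrable Gaussian.\<close>
  define K where "K = k * m / 2"
  have K: "K > 0" using k m by (simp add: K_def)
  show ?thesis
  proof (rule Bochner_Integration.integrable_bound)
    show "integrable lborel (\<lambda>t::real^'n. exp ((r * norm v)\<^sup>2 / (4 * K)) * exp (- K * (norm t)\<^sup>2))"
      using K by (intro integrable_mult_right integrable_exp_norm_square)
    have "- k * ((M *v t) \<bullet> t) + r * \<bar>v \<bullet> t\<bar> \<le> (r * norm v)\<^sup>2 / (4 * K) - K * (norm t)\<^sup>2" for t
    proof -
      have "r * \<bar>v \<bullet> t\<bar> \<le> \<bar>r\<bar> * (norm v * norm t)"
        by (intro mult_mono Cauchy_Schwarz_ineq2) auto
      moreover have "0 \<le> (\<bar>r\<bar> * norm v / (2 * K) - norm t)\<^sup>2 * K" using K by simp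
      moreover have "(\<bar>r\<bar> * norm v / (2 * K) - norm t)\<^sup>2 * K
          = (r * norm v)\<^sup>2 / (4 * K) - \<bar>r\<bar> * (norm v * norm t) + K * (norm t)\<^sup>2"
        using K by (simp add: power2_diff power_mult_distrib power_divide power2_eq_square field_simps)
      moreover have "2 * K * (norm t)\<^sup>2 \<le> k * ((M *v t) \<bullet> t)"
        using mult_left_mono[OF m(2)[of t], of k] k by (simp add: K_def mult.assoc)
      ultimately show ?thesis by linarith
    qed
    then show "AE t in lborel. norm (exp (- k * ((M *v t) \<bullet> t) + r * \<bar>v \<bullet> t\<bar>))
        \<le> norm (exp ((r * norm v)\<^sup>2 / (4 * K)) * exp (- K * (norm t)\<^sup>2))"
      by (intro AE_I2) (simp flip: exp_add)
  qed measurable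
qed

text \<open>Since \<open>M *v w = v\<close>, translating by \<open>(2 * y) *\<^sub>R w\<close>
  completes the square. The factor left over fixes the exact growth rate
  \<open>2 * pi * (v \<bullet> w)\<close> of the holomorphic extension.\<close>

lemma integral_gaussian_form_linear:
  fixes M :: "real^'n::finite^'n"
  assumes M: "sym_pos_def M" and w: "M *v w = v"
  shows "integrable lborel (\<lambda>t. exp (- (pi / 2) * ((M *v t) \<bullet> t) + 2 * pi * y * (v \<bullet> t)))"
    and "(LINT t|lborel. exp (- (pi / 2) * ((M *v t) \<bullet> t) + 2 * pi * y * (v \<bullet> t)))
      = exp (2 * pi * (v \<bullet> w) * y\<^sup>2) * (LINT t|lborel. exp (- (pi / 2) * ((M *v t) \<bullet> t)))"
proof -
  have shift: "- (pi / 2) * ((M *v ((2 * y) *\<^sub>R w + 1 *\<^sub>R t)) \<bullet> ((2 * y) *\<^sub>R w + 1 *\<^sub>R t))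
      + 2 * pi * y * (v \<bullet> ((2 * y) *\<^sub>R w + 1 *\<^sub>R t))
      = 2 * pi * (v \<bullet> w) * y\<^sup>2 + - (pi / 2) * ((M *v t) \<bullet> t)" for t
    using sym_pos_def_symmetric[OF M, of t w]
    by (simp add: matrix_vector_right_distrib matrix_vector_mult_scaleR inner_add_left inner_add_right
        w power2_eq_square inner_commute algebra_simps)
  let ?f = "\<lambda>t. exp (- (pi / 2) * ((M *v t) \<bullet> t) + 2 * pi * y * (v \<bullet> t))"
  have f_meas: "?f \<in> borel_measurable borel" by measurable
  show "integrable lborel ?f"
  proof (rule Bochner_Integration.integrable_bound[OF integrable_gaussian_form[OF M, of "pi / 2" "2 * pi * \<bar>y\<bar>" v]])
    have "y * (v \<bullet> t) \<le> \<bar>y\<bar> * \<bar>v \<bullet> t\<bar>" for t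
      by (metis abs_ge_self abs_mult)
    then show "AE t in lborel. norm (?f t) \<le> norm (exp (- (pi / 2) * ((M *v t) \<bullet> t) + 2 * pi * \<bar>y\<bar> * \<bar>v \<bullet> t\<bar>))"
      by (intro AE_I2) (simp add: mult.assoc)
  qed measurable
  have "(LINT t|lborel. ?f t) = \<bar>1\<bar> ^ DIM(real^'n) *\<^sub>R (LINT t|lborel. ?f ((2 * y) *\<^sub>R w + 1 *\<^sub>R t))"
    by (rule integral_lborel_affine[OF f_meas]) simp
  then show "(LINT t|lborel. ?f t)
      = exp (2 * pi * (v \<bullet> w) * y\<^sup>2) * (LINT t|lborel. exp (- (pi / 2) * ((M *v t) \<bullet> t)))"
    unfolding shift exp_add by simp
qed

text \<open>Taking moduli removes the phase, hence the uniformity in \<open>\<xi>\<close>; the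
  parallelogram identity then leaves the decay in \<open>x\<close> outside the integral.\<close>

lemma wigner_gaussian_bound:
  fixes f :: "real^'n::finite \<Rightarrow> complex"
  assumes M: "sym_pos_def M"
    and bound: "AE x in lborel. cmod (f x) \<le> c * exp (- pi * ((M *v x) \<bullet> x))"
  shows "cmod (wigner f f x \<xi>)
    \<le> c\<^sup>2 * (LINT t|lborel. exp (- (pi / 2) * ((M *v t) \<bullet> t))) * exp (- 2 * pi * ((M *v x) \<bullet> x))"
proof -
  let ?e = "\<lambda>t. exp (- (pi / 2) * ((M *v t) \<bullet> t))"
  have e: "integrable lborel ?e"
    using integrable_gaussian_form[OF M, of "pi / 2" 0] by simp
  have "cmod (wigner f f x \<xi>) \<le> (LINT t|lborel. cmod (f (x + (1/2) *\<^sub>R t) * cnj (f (x - (1/2) *\<^sub>R t))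
                          * exp (- (2 * pi * \<i> * complex_of_real (\<xi> \<bullet> t)))))"
    unfolding wigner_def by (rule integral_norm_bound)
  also have "\<dots> = (LINT t|lborel. cmod (f (x + (1/2) *\<^sub>R t) * cnj (f (x - (1/2) *\<^sub>R t))))"
    by (simp add: norm_mult)
  also have "\<dots> \<le> (LINT t|lborel. c\<^sup>2 * exp (- 2 * pi * ((M *v x) \<bullet> x)) * ?e t)"
  proof (rule integral_mono_AE')
    show "integrable lborel (\<lambda>t. c\<^sup>2 * exp (- 2 * pi * ((M *v x) \<bullet> x)) * ?e t)"
      by (intro integrable_mult_right e)
    show "AE t in lborel. cmod (f (x + (1/2) *\<^sub>R t) * cnj (f (x - (1/2) *\<^sub>R t)))
        \<le> c\<^sup>2 * exp (- 2 * pi * ((M *v x) \<bullet> x)) * ?e t"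
      using AE_lborel_affine[where c = "1 / 2" and t = x, OF bound, simplified]
        AE_lborel_affine[where c = "- (1 / 2)" and t = x, OF bound, simplified]
    proof eventually_elim
      case (elim t)
      then show ?case by (intro gaussian_product_bound) simp_all
    qed
  qed auto
  finally show ?thesis by (simp add: mult_ac)
qed

text \<open>For fixed \<open>x\<close> the Wigner distribution is the Fourier transform of the
  continuous function \<open>?G\<close>, whose value at \<open>t = 0\<close> is the squared modulus
  of \<open>f x\<close>.\<close>

lemma wigner_self_zero_imp_zero:
  fixes f :: "real^'n::finite \<Rightarrow> complex"
  assumes cont: "continuous_on UNIV f" and M: "sym_pos_def M"
    and bound: "\<And>x. cmod (f x) \<le> c * exp (- pi * ((M *v x) \<bullet> x))"
    and zero: "\<And>\<xi>. wigner f f x \<xi> = 0"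
  shows "f x = 0"
proof -
  let ?G = "\<lambda>t. f (x + (1/2) *\<^sub>R t) * cnj (f (x - (1/2) *\<^sub>R t))"
  let ?C = "c\<^sup>2 * exp (- 2 * pi * ((M *v x) \<bullet> x))"
  have G: "cmod (?G t) \<le> ?C * exp (- (pi / 2) * ((M *v t) \<bullet> t))" for t
    by (intro gaussian_product_bound bound)
  have contG: "continuous_on UNIV ?G"
    by (intro continuous_intros continuous_on_compose2[OF cont]) auto
  then have [measurable]: "?G \<in> borel_measurable borel" by (rule borel_measurable_continuous_onI)
  have "?G 0 = 0"
  proof (rule fourier_zero_imp_zero)
    have "integrable lborel (\<lambda>t. ?C * exp (- (pi / 2) * ((M *v t) \<bullet> t)))"
      using integrable_gaussian_form[OF M, of "pi / 2" 0] by (intro integrable_mult_right) simp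
    then show "integrable lborel ?G"
      by (rule Bochner_Integration.integrable_bound) (use G in \<open>auto intro: order_trans[OF _ abs_ge_self]\<close>)
    show "cmod (?G t) \<le> ?C" for t
    proof -
      have "0 \<le> (M *v t) \<bullet> t"
        using M by (cases "t = 0") (auto simp: sym_pos_def_def inner_commute less_imp_le)
      then have "?C * exp (- (pi / 2) * ((M *v t) \<bullet> t)) \<le> ?C * 1"
        by (intro mult_left_mono) auto
      with G[of t] show ?thesis by simp
    qed
    show "(LINT t|lborel. ?G t * iexp (\<xi> \<bullet> t)) = 0" for \<xi>
      \<comment> \<open>The rescaled frequency converts the phase \<open>- 2 * pi * \<i>\<close> of
        the Wigner convention into \<open>iexp\<close>.\<close>
      using zero[of "(- 1 / (2 * pi)) *\<^sub>R \<xi>"] by (simp add: wigner_def field_simps)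
  qed (rule contG)
  then show ?thesis by simp
qed

text \<open>Making the shift along \<open>v\<close> complex turns the integral into a Laplace
  transform in \<open>v \<bullet> t\<close> evaluated at \<open>- (2 * pi * \<i>) * z\<close>. The
  extra phase then has modulus \<open>exp (2 * pi * Im z * (v \<bullet> t))\<close>, and the linear
  Gaussian integral gives the growth.\<close>

lemma wigner_holomorphic_extension:
  fixes f :: "real^'n::finite \<Rightarrow> complex"
  assumes [measurable]: "f \<in> borel_measurable borel" and M: "sym_pos_def M" and w: "M *v w = v"
    and bound: "\<And>x. cmod (f x) \<le> c * exp (- pi * ((M *v x) \<bullet> x))"
  obtains h C where "h holomorphic_on UNIV" "\<And>s. h (of_real s) = wigner f f x (\<xi> + s *\<^sub>R v)"
    "\<And>z. cmod (h z) \<le> C * exp (2 * pi * (v \<bullet> w) * (Im z)\<^sup>2)"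
proof
  let ?G = "\<lambda>t. f (x + (1/2) *\<^sub>R t) * cnj (f (x - (1/2) *\<^sub>R t)) * exp (- (2 * pi * \<i> * complex_of_real (\<xi> \<bullet> t)))"
  let ?C = "c\<^sup>2 * exp (- 2 * pi * ((M *v x) \<bullet> x))"
  let ?L = "\<lambda>z. LINT t|lborel. ?G t * exp (z * of_real (v \<bullet> t))"
  let ?h = "\<lambda>z. ?L (- (2 * pi * \<i>) * z)"
  have G: "cmod (?G t) \<le> ?C * exp (- (pi / 2) * ((M *v t) \<bullet> t))" for t
    using gaussian_product_bound[OF bound bound] by (simp add: norm_mult)
  have "?L holomorphic_on UNIV"
  proof (rule holomorphic_laplace_transform)
    fix r
    show "integrable lborel (\<lambda>t. cmod (?G t) * exp (r * \<bar>v \<bullet> t\<bar>))"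
    proof (rule Bochner_Integration.integrable_bound)
      show "integrable lborel (\<lambda>t. ?C * exp (- (pi / 2) * ((M *v t) \<bullet> t) + r * \<bar>v \<bullet> t\<bar>))"
        by (intro integrable_mult_right integrable_gaussian_form M) simp
      have "cmod (?G t) * exp (r * \<bar>v \<bullet> t\<bar>) \<le> ?C * exp (- (pi / 2) * ((M *v t) \<bullet> t) + r * \<bar>v \<bullet> t\<bar>)" for t
        unfolding exp_add mult.assoc[symmetric] using G[of t] by (intro mult_right_mono) auto
      then show "AE t in lborel. norm (cmod (?G t) * exp (r * \<bar>v \<bullet> t\<bar>))
          \<le> norm (?C * exp (- (pi / 2) * ((M *v t) \<bullet> t) + r * \<bar>v \<bullet> t\<bar>))"
        by (intro AE_I2) (simp only: real_norm_def abs_mult abs_norm_cancel abs_exp_cancel abs_power2)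
    qed measurable
  qed measurable
  then have "(?L \<circ> (\<lambda>z. - (2 * pi * \<i>) * z)) holomorphic_on UNIV"
    by (intro holomorphic_on_compose holomorphic_intros) (auto intro: holomorphic_on_subset)
  then show "?h holomorphic_on UNIV" by (simp only: o_def)
  show "?h (of_real s) = wigner f f x (\<xi> + s *\<^sub>R v)" for s
    unfolding wigner_def
    by (intro Bochner_Integration.integral_cong refl) (simp add: inner_add_left algebra_simps flip: exp_add)
  show "cmod (?h z) \<le> ?C * (LINT t|lborel. exp (- (pi / 2) * ((M *v t) \<bullet> t))) * exp (2 * pi * (v \<bullet> w) * (Im z)\<^sup>2)" for z
  proof -
    have "cmod (?h z) \<le> (LINT t|lborel. cmod (?G t * exp (- (2 * pi * \<i>) * z * of_real (v \<bullet> t))))"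
      by (rule integral_norm_bound)
    also have "\<dots> \<le> (LINT t|lborel. ?C * exp (- (pi / 2) * ((M *v t) \<bullet> t) + 2 * pi * Im z * (v \<bullet> t)))"
    proof (rule integral_mono')
      show "integrable lborel (\<lambda>t. ?C * exp (- (pi / 2) * ((M *v t) \<bullet> t) + 2 * pi * Im z * (v \<bullet> t)))"
        by (intro integrable_mult_right integral_gaussian_form_linear(1)[OF M w])
      fix t
      have "cmod (exp (- (2 * pi * \<i>) * z * of_real (v \<bullet> t))) = exp (2 * pi * Im z * (v \<bullet> t))"
        by (simp add: norm_exp_eq_Re)
      then show "cmod (?G t * exp (- (2 * pi * \<i>) * z * of_real (v \<bullet> t)))
          \<le> ?C * exp (- (pi / 2) * ((M *v t) \<bullet> t) + 2 * pi * Im z * (v \<bullet> t))"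
        unfolding norm_mult[of "?G t"] exp_add mult.assoc[symmetric, of ?C]
        using G[of t] by (intro mult_mono) auto
    qed simp
    also have "\<dots> = ?C * (LINT t|lborel. exp (- (pi / 2) * ((M *v t) \<bullet> t))) * exp (2 * pi * (v \<bullet> w) * (Im z)\<^sup>2)"
      using integral_gaussian_form_linear(2)[OF M w, of "Im z"] by simp
    finally show ?thesis .
  qed
qed

text \<open>Along the line the form is quadratic in \<open>s\<close> with leading coefficient
  \<open>(N *v u) \<bullet> u\<close>. The gap \<open>\<delta>\<close> to \<open>b\<close> pays for
  the cross term by completing the square, at the cost of a constant depending on
  \<open>p\<close>.\<close>

lemma gaussian_form_shift_bound:
  fixes N :: "real^'n::finite^'n"
  assumes N: "sym_pos_def N" and b: "b < (N *v u) \<bullet> u"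
  obtains K where "\<And>s. exp (- 2 * pi * ((N *v (p + s *\<^sub>R u)) \<bullet> (p + s *\<^sub>R u))) \<le> K * exp (- (2 * pi * b) * s\<^sup>2)"
proof
  define \<delta> where "\<delta> = (N *v u) \<bullet> u - b"
  have \<delta>: "\<delta> > 0" using b by (simp add: \<delta>_def)
  let ?k = "(N *v p) \<bullet> u"
  fix s
  have "(N *v (p + s *\<^sub>R u)) \<bullet> (p + s *\<^sub>R u) = (N *v p) \<bullet> p + 2 * s * ?k + s\<^sup>2 * ((N *v u) \<bullet> u)"
    using sym_pos_def_symmetric[OF N, of u p]
    by (simp add: matrix_vector_right_distrib matrix_vector_mult_scaleR inner_add_left inner_add_right
        power2_eq_square inner_commute algebra_simps)
  moreover have "0 \<le> \<delta> * (s + ?k / \<delta>)\<^sup>2" using \<delta> by simp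
  moreover have "\<delta> * (s + ?k / \<delta>)\<^sup>2 = \<delta> * s\<^sup>2 + 2 * s * ?k + ?k\<^sup>2 / \<delta>"
    using \<delta> by (simp add: power2_sum power_divide power2_eq_square field_simps)
  ultimately have "b * s\<^sup>2 + ((N *v p) \<bullet> p - ?k\<^sup>2 / \<delta>) \<le> (N *v (p + s *\<^sub>R u)) \<bullet> (p + s *\<^sub>R u)"
    by (simp add: \<delta>_def algebra_simps)
  then have "2 * pi * (b * s\<^sup>2 + ((N *v p) \<bullet> p - ?k\<^sup>2 / \<delta>)) \<le> 2 * pi * ((N *v (p + s *\<^sub>R u)) \<bullet> (p + s *\<^sub>R u))"
    by (intro mult_left_mono) auto
  then show "exp (- 2 * pi * ((N *v (p + s *\<^sub>R u)) \<bullet> (p + s *\<^sub>R u)))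
      \<le> exp (- 2 * pi * ((N *v p) \<bullet> p - ?k\<^sup>2 / \<delta>)) * exp (- (2 * pi * b) * s\<^sup>2)"
    by (simp add: algebra_simps flip: exp_add)
qed

section \<open>Uniqueness from growth against decay along an eigenvector line\<close>

theorem theorem1p7:
  fixes MM :: "real^('n::finite + 'n)^('n + 'n)"
    and M N :: "real^'n^'n"
    and Sh :: "real \<Rightarrow> (real^'n \<Rightarrow> complex) \<Rightarrow> (real^'n \<Rightarrow> complex)"
    and u0 :: "real^'n \<Rightarrow> complex"
    and t1 c :: real
  assumes MM_sym: "transpose MM = MM"
    and lift: "metaplectic_lift Sh (symp_flow MM)"
    and u0_S: "schwartz u0"
    and M_pd: "sym_pos_def M"
    and N_pd: "sym_pos_def N"
    and c_pos: "c > 0"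
    and bound0: "\<forall>x. cmod (u0 x) \<le> c * exp (- pi * ((M *v x) \<bullet> x))"
    and bound1: "AE x in lborel. cmod (Sh t1 u0 x) \<le> c * exp (- pi * ((N *v x) \<bullet> x))"
    and B_inv: "invertible (ublock (symp_flow MM t1))"
    and eig: "\<exists>lam. mat_eigenvalue (M ** transpose (ublock (symp_flow MM t1)) ** N ** ublock (symp_flow MM t1)) lam \<and> lam > 1"
  shows "u0 = (\<lambda>x. 0)"
proof -
  define S where "S = symp_flow MM t1"
  define B where "B = ublock S"
  obtain lam v where lam: "lam > 1" and v: "v \<noteq> 0"
    and eigv: "(M ** transpose B ** N ** B) *v v = lam *\<^sub>R v"
    using eig by (auto simp: mat_eigenvalue_def B_def S_def)
  \<comment> \<open>The eigenvalue equation itself provides a preimage of \<open>v\<close> under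
    \<open>M\<close>.\<close>
  define w where "w = (1 / lam) *\<^sub>R (transpose B *v (N *v (B *v v)))"
  have w: "M *v w = v"
  proof -
    have "M *v w = (1 / lam) *\<^sub>R ((M ** transpose B ** N ** B) *v v)"
      by (simp add: w_def matrix_vector_mult_scaleR matrix_vector_mul_assoc matrix_mul_assoc)
    then show ?thesis using lam by (simp add: eigv)
  qed
  have "w \<noteq> 0" using w v by auto
  then have vw: "0 < v \<bullet> w" using M_pd w by (auto simp: sym_pos_def_def inner_commute)
  \<comment> \<open>Up to the common factor \<open>2 * pi\<close>, this compares the two rates: the
    decay coefficient is \<open>lam\<close> times the growth coefficient.\<close>
  have "(N *v (B *v v)) \<bullet> (B *v v) = lam * (v \<bullet> w)"
  proof -
    have "v \<bullet> (transpose B *v (N *v (B *v v))) = (N *v (B *v v)) \<bullet> (B *v v)"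
      by (metis dot_lmul_matrix inner_commute transpose_matrix_vector)
    then show ?thesis using lam by (simp add: w_def)
  qed
  then have "v \<bullet> w < (N *v (B *v v)) \<bullet> (B *v v)" using lam vw by simp
  \<comment> \<open>An intermediate rate leaves room both for the cross term in the decay estimate
    and for the strict inequality in Hardy's theorem.\<close>
  then obtain b where b: "v \<bullet> w < b" "b < (N *v (B *v v)) \<bullet> (B *v v)" using dense by blast
  have cont: "continuous_on UNIV u0"
  proof -
    have "u0 differentiable at x" for x using u0_S unfolding schwartz_def by (metis dderiv.simps(1))
    then show ?thesis
      by (auto intro!: differentiable_imp_continuous_on simp: differentiable_on_def)
  qed
  then have meas: "u0 \<in> borel_measurable borel" by (rule borel_measurable_continuous_onI)
  have bound0': "cmod (u0 x) \<le> c * exp (- pi * ((M *v x) \<bullet> x))" for x using bound0 by blast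
  have "sq_int u0" by (rule sq_int_gaussian_bound[OF meas M_pd bound0'])
  moreover have "metaplectic_with_proj (Sh t1) S" using lift by (simp add: metaplectic_lift_def S_def)
  \<comment> \<open>Evaluating covariance at \<open>S *v z\<close> cancels the inverse, so both
    Wigner distributions are read along explicit lines.\<close>
  ultimately have covariance: "wigner (Sh t1 u0) (Sh t1 u0) (ppos (S *v z)) (pmom (S *v z))
      = wigner u0 u0 (ppos z) (pmom z)" for z
    using invertible_symp_flow[of MM t1]
    by (simp add: metaplectic_with_proj_def matrix_inv_mult_vec S_def)
  have "wigner u0 u0 x \<xi> = 0" for x \<xi>
  proof -
    obtain h C1 where h: "h holomorphic_on UNIV" "\<And>s. h (of_real s) = wigner u0 u0 x (\<xi> + s *\<^sub>R v)"
      "\<And>z. cmod (h z) \<le> C1 * exp (2 * pi * (v \<bullet> w) * (Im z)\<^sup>2)"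
      using wigner_holomorphic_extension[OF meas M_pd w bound0'] by metis
    let ?p = "ppos (S *v pjoin x \<xi>)"
    obtain K where K: "\<And>s. exp (- 2 * pi * ((N *v (?p + s *\<^sub>R (B *v v))) \<bullet> (?p + s *\<^sub>R (B *v v))))
        \<le> K * exp (- (2 * pi * b) * s\<^sup>2)"
      using gaussian_form_shift_bound[OF N_pd b(2)] by metis
    let ?I = "LINT t|lborel. exp (- (pi / 2) * ((N *v t) \<bullet> t))"
    define C2 where "C2 = c\<^sup>2 * ?I * K"
    have decay: "cmod (h (of_real s)) \<le> C2 * exp (- (2 * pi * b) * s\<^sup>2)" for s
    proof -
      let ?z = "pjoin x (\<xi> + s *\<^sub>R v)"
      have "h (of_real s) = wigner (Sh t1 u0) (Sh t1 u0) (ppos (S *v ?z)) (pmom (S *v ?z))"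
        by (simp add: h(2) covariance)
      also have "ppos (S *v ?z) = ?p + s *\<^sub>R (B *v v)"
        by (simp add: ppos_mult_pjoin_shift B_def)
      finally have "cmod (h (of_real s)) \<le> c\<^sup>2 * ?I
          * exp (- 2 * pi * ((N *v (?p + s *\<^sub>R (B *v v))) \<bullet> (?p + s *\<^sub>R (B *v v))))"
        using wigner_gaussian_bound[OF N_pd bound1] by simp
      also have "\<dots> \<le> c\<^sup>2 * ?I * (K * exp (- (2 * pi * b) * s\<^sup>2))"
        by (intro mult_left_mono K mult_nonneg_nonneg Bochner_Integration.integral_nonneg) auto
      finally show ?thesis by (simp add: C2_def mult.assoc)
    qed
    \<comment> \<open>The larger of \<open>C1\<close> and \<open>C2\<close> serves as the common
      constant. The base point \<open>\<xi>\<close> is arbitrary, so the value at the origin of each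
      line already gives vanishing everywhere.\<close>
    have "h 0 = 0"
    proof (rule hardy_entire[OF h(1)])
      show "cmod (h z) \<le> max C1 C2 * exp (2 * pi * (v \<bullet> w) * (Im z)\<^sup>2)" for z
        by (rule order_trans[OF h(3)]) (intro mult_right_mono; simp)
      show "cmod (h (of_real s)) \<le> max C1 C2 * exp (- (2 * pi * b) * s\<^sup>2)" for s
        by (rule order_trans[OF decay]) (intro mult_right_mono; simp)
    qed (use vw b in auto)
    then show ?thesis using h(2)[of 0] by simp
  qed
  then show ?thesis
    using wigner_self_zero_imp_zero[OF cont M_pd bound0'] by blast
qed

end
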